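(* Let $\mathbb{F}$ be any field and $n\ge1$. Then $\operatorname{Trank}(\det^n_{\mathbb{F}})\ge\binom{n}{\lfloor n/2\rfloor}+1$ and $\operatorname{Trank}(\operatorname{per}^n_{\mathbb{F}})\ge\binom{n}{\lfloor n/2\rfloor}+1$.
   Context: $\det^n_{\mathbb{F}}=\sum_{\sigma\in S_n}\operatorname{sgn}(\sigma)\mathbf{e}_{\sigma(1)}\otimes\cdots\otimes\mathbf{e}_{\sigma(n)}$ and $\operatorname{per}^n_{\mathbb{F}}=\sum_{\sigma\in S_n}\mathbf{e}_{\sigma(1)}\otimes\cdots\otimes\mathbf{e}_{\sigma(n)}$ in $(\mathbb{F}^n)^{\otimes n}$, with $\mathbf{e}_j$ the standard basis of $\mathbb{F}^n$; $\operatorname{Trank}$ is tensor rank (least number of elementary tensors $\mathbf{v_1}\otimes\cdots\otimes\mathbf{v_n}$, $\mathbf{v_i}\in\mathbb{F}^n$, summing to the tensor).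
   Formalization: The formal theorem assumes n ≥ 3 instead of n ≥ 1, since the bound fails over every field for n = 1 (rank 1, bound 2) and n = 2 (rank at most 2, bound 3). *)

theory Defs
  imports
    "HOL-Library.FuncSet"
    "HOL-Combinatorics.Permutations"
    "Jordan_Normal_Form.Matrix"
begin

text \<open>
  A tensor in the \<open>d\<close>-fold tensor power of \<open>F\<^sup>n\<close> is represented by its coordinates with respect to
  the basis induced by the standard basis of \<open>F\<^sup>n\<close>. The coordinates are indexed by the functions
  from \<open>{..<d}\<close> to \<open>{..<n}\<close> (indices are 0-based) and are set to zero off this index set, so that
  equality of tensors is equality of functions.
\<close>

type_synonym 'a tensor = "(nat \<Rightarrow> nat) \<Rightarrow> 'a"

definition multi_indices :: "nat \<Rightarrow> nat \<Rightarrow> (nat \<Rightarrow> nat) set" where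
  "multi_indices n d = {..<d} \<rightarrow>\<^sub>E {..<n}"

definition elementary_tensor :: "nat \<Rightarrow> nat \<Rightarrow> (nat \<Rightarrow> 'a::field vec) \<Rightarrow> 'a tensor" where
  "elementary_tensor n d v =
     (\<lambda>\<iota>. if \<iota> \<in> multi_indices n d then (\<Prod>i<d. v i $ \<iota> i) else 0)"

definition is_sum_of_elementary :: "nat \<Rightarrow> nat \<Rightarrow> 'a::field tensor \<Rightarrow> nat \<Rightarrow> bool" where
  "is_sum_of_elementary n d T r \<longleftrightarrow>
     (\<exists>v :: nat \<Rightarrow> nat \<Rightarrow> 'a vec.
        (\<forall>j<r. \<forall>i<d. v j i \<in> carrier_vec n) \<and>
        T = (\<lambda>\<iota>. \<Sum>j<r. elementary_tensor n d (v j) \<iota>))"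

definition Trank :: "nat \<Rightarrow> nat \<Rightarrow> 'a::field tensor \<Rightarrow> nat" where
  "Trank n d T = (LEAST r. is_sum_of_elementary n d T r)"

definition det_tensor :: "nat \<Rightarrow> 'a::field tensor" where
  "det_tensor n =
     (\<lambda>\<iota>. \<Sum>\<sigma> | \<sigma> permutes {..<n}.
        of_int (sign \<sigma>) * elementary_tensor n n (\<lambda>i. unit_vec n (\<sigma> i)) \<iota>)"

definition per_tensor :: "nat \<Rightarrow> 'a::field tensor" where
  "per_tensor n =
     (\<lambda>\<iota>. \<Sum>\<sigma> | \<sigma> permutes {..<n}. elementary_tensor n n (\<lambda>i. unit_vec n (\<sigma> i)) \<iota>)"

text \<open>
  Taking all permutations as summands bounds both tensor ranks by \<open>n!\<close>. For \<open>n = 1, 2\<close> this is smaller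
  than \<open>(n choose (n div 2)) + 1\<close>, so a lower bound of that size can only hold for \<open>n \<ge> 3\<close>.
\<close>

end

theory Submission
  imports Defs "Jordan_Normal_Form.Determinant"
begin

text \<open>
  Split the tensor factors into the first \<open>m = n - n div 2 \<ge> 2\<close> and the remaining ones. The induced
  matrix has rank \<open>n choose m\<close>, so the tensor rank is at least that. If a decomposition had only
  \<open>n choose m\<close> terms, the factorisation of the flattening would be through invertible matrices, so
  each elementary tensor formed by the first \<open>m\<close> factors of a term would be a linear combination of
  slices of the tensor. Such a combination vanishes on multi-indices with a repetition and is, up to
  sign, invariant under swapping the first two slots; a nonzero elementary tensor cannot have both
  properties.
\<close>

section \<open>Splicing multi-indices and enumerating subsets by permutations\<close>

text \<open>Both arguments are full multi-indices, although only the first block of \<open>p\<close>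
  and the last block of \<open>q\<close> count. Rows and columns of the flattening thus share one
  index set, and splicing \<open>p\<close> with itself returns \<open>p\<close>.\<close>

definition splice_index :: "nat \<Rightarrow> (nat \<Rightarrow> nat) \<Rightarrow> (nat \<Rightarrow> nat) \<Rightarrow> nat \<Rightarrow> nat" where
  "splice_index m p q = (\<lambda>i. if i < m then p i else q i)"

lemma splice_index_in_multi_indices:
  assumes "m \<le> n" "p \<in> multi_indices n n" "q \<in> multi_indices n n"
  shows "splice_index m p q \<in> multi_indices n n"
  using assms by (auto simp: splice_index_def multi_indices_def PiE_iff extensional_def)

lemma multi_indices_comp_transpose:
  assumes "a < d" "b < d" "p \<in> multi_indices n d"
  shows "p \<circ> transpose a b \<in> multi_indices n d"
  using assms by (auto simp: multi_indices_def PiE_iff extensional_def transpose_def)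

lemma restrict_permutes_multi_indices:
  assumes "\<sigma> permutes {..<n}"
  shows "restrict \<sigma> {..<n} \<in> multi_indices n n"
  using permutes_in_image[OF assms] by (auto simp: multi_indices_def)

text \<open>An injective self-map of a finite set is onto. The restriction reconciles two
  conventions: off \<open>{..<n}\<close> a permutation is the identity, a multi-index is
  \<open>undefined\<close>.\<close>

lemma inj_multi_index_permutes:
  assumes "\<iota> \<in> multi_indices n n" "inj_on \<iota> {..<n}"
  obtains \<sigma> where "\<sigma> permutes {..<n}" "\<iota> = restrict \<sigma> {..<n}"
proof -
  define \<sigma> where "\<sigma> = (\<lambda>i. if i < n then \<iota> i else i)"
  have sub: "\<iota> ` {..<n} \<subseteq> {..<n}"
    using assms(1) by (auto simp: multi_indices_def)
  have "\<iota> ` {..<n} = {..<n}"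
    using endo_inj_surj[OF _ sub assms(2)] by simp
  hence "bij_betw \<iota> {..<n} {..<n}"
    using assms(2) by (simp add: bij_betw_def)
  hence "bij_betw \<sigma> {..<n} {..<n}"
    by (subst bij_betw_cong[of _ _ \<iota>]) (auto simp: \<sigma>_def)
  hence "\<sigma> permutes {..<n}"
    by (rule bij_imp_permutes) (simp add: \<sigma>_def)
  moreover have "\<iota> = restrict \<sigma> {..<n}"
    using assms(1) by (auto simp: \<sigma>_def multi_indices_def PiE_iff extensional_def restrict_def fun_eq_iff)
  ultimately show ?thesis by (rule that)
qed

text \<open>Glue a bijection from \<open>{..<m}\<close> to \<open>X\<close> with one between the
  complements in \<open>{..<n}\<close>.\<close>

lemma obtain_permutes_image:
  assumes "X \<subseteq> {..<n}" "card X = m"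
  obtains \<sigma> where "\<sigma> permutes {..<n}" "\<sigma> ` {..<m} = X"
proof -
  have fX: "finite X" using assms(1) finite_subset by blast
  have mn: "m \<le> n" using assms card_mono[OF _ assms(1)] by simp
  obtain f where f: "bij_betw f {..<m} X"
    using finite_same_card_bij[of "{..<m}" X] assms fX by auto
  have "card ({..<n} - X) = card {m..<n}"
    using assms fX by (simp add: card_Diff_subset)
  then obtain g where g: "bij_betw g {m..<n} ({..<n} - X)"
    using finite_same_card_bij[of "{m..<n}" "{..<n} - X"] by auto
  define \<sigma> where "\<sigma> = (\<lambda>i. if i < m then f i else if i < n then g i else i)"
  have 1: "bij_betw \<sigma> {..<m} X"
    using f by (subst bij_betw_cong[of _ _ f]) (auto simp: \<sigma>_def)
  have 2: "bij_betw \<sigma> {m..<n} ({..<n} - X)"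
    using g mn by (subst bij_betw_cong[of _ _ g]) (auto simp: \<sigma>_def)
  have "{..<m} \<union> {m..<n} = {..<n}" "X \<union> ({..<n} - X) = {..<n}"
    using mn assms(1) by auto
  with bij_betw_combine[OF 1 2] have "bij_betw \<sigma> {..<n} {..<n}"
    by simp
  hence "\<sigma> permutes {..<n}"
    by (rule bij_imp_permutes) (use mn in \<open>simp add: \<sigma>_def\<close>)
  with that 1 show ?thesis by (auto simp: bij_betw_def)
qed

text \<open>Each \<open>m\<close>-subset is represented by a permutation mapping
  \<open>{..<m}\<close> onto it. If the splice is injective, the first block of
  \<open>\<pi> x\<close> avoids the last block of \<open>\<pi> y\<close>, so the subset of
  \<open>x\<close> lies in that of \<open>y\<close>, and equal cardinality makes them equal. These
  indices therefore select a diagonal submatrix of the flattening.\<close>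

lemma obtain_subset_enumeration:
  assumes "m \<le> n"
  obtains \<pi> where
    "\<And>x. x < n choose m \<Longrightarrow> \<pi> x \<in> multi_indices n n \<and> inj_on (\<pi> x) {..<n}"
    "\<And>x y. \<lbrakk>x < n choose m; y < n choose m; inj_on (splice_index m (\<pi> x) (\<pi> y)) {..<n}\<rbrakk> \<Longrightarrow> x = y"
proof -
  let ?S = "{X. X \<subseteq> {..<n} \<and> card X = m}"
  have cS: "card ?S = n choose m"
    using n_subsets[of "{..<n}" m] by simp
  obtain h where h: "bij_betw h {..<n choose m} ?S"
    using finite_same_card_bij[of "{..<n choose m}" ?S] cS by auto
  have "\<exists>\<sigma>. \<sigma> permutes {..<n} \<and> \<sigma> ` {..<m} = h x" if "x < n choose m" for x
  proof -
    have "h x \<in> ?S" using h that by (auto simp: bij_betw_def)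
    then obtain \<sigma> where "\<sigma> permutes {..<n}" "\<sigma> ` {..<m} = h x"
      by (auto intro: obtain_permutes_image[of "h x" n m])
    thus ?thesis by blast
  qed
  then obtain \<sigma> where \<sigma>: "\<And>x. x < n choose m \<Longrightarrow> \<sigma> x permutes {..<n} \<and> \<sigma> x ` {..<m} = h x"
    by metis
  define \<pi> where "\<pi> = (\<lambda>x. restrict (\<sigma> x) {..<n})"
  have "\<pi> x \<in> multi_indices n n \<and> inj_on (\<pi> x) {..<n}" if "x < n choose m" for x
    using \<sigma>[OF that] restrict_permutes_multi_indices permutes_inj_on
    by (auto simp: \<pi>_def inj_on_restrict_eq)
  moreover have "x = y"
    if x: "x < n choose m" and y: "y < n choose m"
      and inj: "inj_on (splice_index m (\<pi> x) (\<pi> y)) {..<n}" for x y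
  proof -
    have "h x \<subseteq> h y"
    proof
      fix a assume "a \<in> h x"
      then obtain i where i: "i < m" "a = \<sigma> x i" using \<sigma>[OF x] by auto
      have "a \<in> {..<n}" using i assms permutes_in_image \<sigma>[OF x] by fastforce
      then obtain k where k: "k < n" "a = \<sigma> y k"
        using \<sigma>[OF y] permutes_image by (metis imageE lessThan_iff)
      have "k < m"
      proof (rule ccontr)
        assume "\<not> k < m"
        hence "splice_index m (\<pi> x) (\<pi> y) i = splice_index m (\<pi> x) (\<pi> y) k" "i \<noteq> k"
          using i k assms by (auto simp: splice_index_def \<pi>_def)
        with inj i k assms show False by (auto simp: inj_on_def)
      qed
      thus "a \<in> h y" using \<sigma>[OF y] k by auto
    qed
    moreover have "h x \<in> ?S" "h y \<in> ?S" using h x y by (auto simp: bij_betw_def)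
    ultimately have "h x = h y"
      by (metis (mono_tags, lifting) card_subset_eq finite_lessThan finite_subset mem_Collect_eq)
    thus "x = y" using h x y by (auto simp: bij_betw_def inj_on_def)
  qed
  ultimately show ?thesis by (rule that)
qed

section \<open>Lower bound for tensors supported on the injective multi-indices\<close>

text \<open>The hypotheses collect what determinant and permanent share; the factor \<epsilon> is -1
  for the former and 1 for the latter. The bound \<open>2 \<le> m\<close> puts the swapped slots 0
  and 1 into the same block.\<close>

lemma is_sum_of_elementary_gt_choose:
  fixes T :: "'a::field tensor"
  assumes "2 \<le> m" "m \<le> n"
    and nonzero: "\<And>\<iota>. \<lbrakk>\<iota> \<in> multi_indices n n; inj_on \<iota> {..<n}\<rbrakk> \<Longrightarrow> T \<iota> \<noteq> 0"
    and zero: "\<And>\<iota>. \<lbrakk>\<iota> \<in> multi_indices n n; \<not> inj_on \<iota> {..<n}\<rbrakk> \<Longrightarrow> T \<iota> = 0"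
    and swap: "\<And>\<iota>. \<iota> \<in> multi_indices n n \<Longrightarrow> T (\<iota> \<circ> transpose 0 1) = \<epsilon> * T \<iota>" and "\<epsilon> \<noteq> 0"
    and "is_sum_of_elementary n n T r"
  shows "n choose m < r"
proof (rule ccontr)
  assume "\<not> n choose m < r"
  hence r: "r \<le> n choose m" by simp
  define N where "N = n choose m"
  have N: "0 < N" using \<open>m \<le> n\<close> by (simp add: N_def)
  obtain v :: "nat \<Rightarrow> nat \<Rightarrow> 'a vec" where T: "T = (\<lambda>\<iota>. \<Sum>j<r. elementary_tensor n n (v j) \<iota>)"
    using assms(7) by (auto simp: is_sum_of_elementary_def)
  obtain \<pi> where \<pi>: "\<And>x. x < N \<Longrightarrow> \<pi> x \<in> multi_indices n n" "\<And>x. x < N \<Longrightarrow> inj_on (\<pi> x) {..<n}"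
    and \<pi>_eq: "\<And>x y. \<lbrakk>x < N; y < N; inj_on (splice_index m (\<pi> x) (\<pi> y)) {..<n}\<rbrakk> \<Longrightarrow> x = y"
    using obtain_subset_enumeration[OF \<open>m \<le> n\<close>] unfolding N_def by metis
  \<comment> \<open>Setting the factors to zero for \<open>r \<le> j < N\<close> pads the decomposition to exactly \<open>N\<close> terms.\<close>
  define b where "b j p = (if j < r then \<Prod>i<m. v j i $ p i else 0)" for j and p :: "nat \<Rightarrow> nat"
  define a where "a j q = (if j < r then \<Prod>i=m..<n. v j i $ q i else 0)" for j and q :: "nat \<Rightarrow> nat"
  \<comment> \<open>These are the diagonal entries of the selected submatrix.\<close>
  define D where "D x = T (\<pi> x)" for x
  have D: "D x \<noteq> 0" if "x < N" for x
    using nonzero \<pi> that by (simp add: D_def)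
  have T_splice: "T (splice_index m p q) = (\<Sum>j<N. b j p * a j q)"
    if "p \<in> multi_indices n n" "q \<in> multi_indices n n" for p q
  proof -
    have "elementary_tensor n n (v j) (splice_index m p q) = b j p * a j q" if "j < r" for j
    proof -
      have "{..<n} = {..<m} \<union> {m..<n}" using \<open>m \<le> n\<close> by auto
      hence "(\<Prod>i<n. v j i $ splice_index m p q i)
          = (\<Prod>i<m. v j i $ splice_index m p q i) * (\<Prod>i=m..<n. v j i $ splice_index m p q i)"
        by (simp add: prod.union_disjoint[symmetric] ivl_disj_int)
      thus ?thesis
        using splice_index_in_multi_indices[OF \<open>m \<le> n\<close> \<open>p \<in> _\<close> \<open>q \<in> _\<close>] that
        by (simp add: elementary_tensor_def a_def b_def splice_index_def)
    qed
    hence "T (splice_index m p q) = (\<Sum>j<r. b j p * a j q)"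
      by (simp add: T)
    also have "\<dots> = (\<Sum>j<N. b j p * a j q)"
      by (rule sum.mono_neutral_left) (use r in \<open>auto simp: N_def a_def\<close>)
    finally show ?thesis .
  qed
  \<comment> \<open>Dividing row \<open>x\<close> by \<open>D x\<close> normalises the diagonal
    submatrix, so that the product becomes the identity.\<close>
  define P where "P = mat N N (\<lambda>(x, j). b j (\<pi> x) / D x)"
  define Q where "Q = mat N N (\<lambda>(j, y). a j (\<pi> y))"
  have PQ_carrier: "P \<in> carrier_mat N N" "Q \<in> carrier_mat N N"
    by (auto simp: P_def Q_def)
  have "P * Q = 1\<^sub>m N"
  proof (rule eq_matI)
    fix x y assume "x < dim_row (1\<^sub>m N)" "y < dim_col (1\<^sub>m N)"
    hence xy: "x < N" "y < N" by auto
    have "(P * Q) $$ (x, y) = (\<Sum>j<N. b j (\<pi> x) / D x * a j (\<pi> y))"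
      using xy by (simp add: P_def Q_def scalar_prod_def lessThan_atLeast0)
    also have "\<dots> = T (splice_index m (\<pi> x) (\<pi> y)) / D x"
      using xy by (simp add: T_splice \<pi> sum_divide_distrib)
    also have "\<dots> = (if x = y then 1 else 0)"
    proof (cases "x = y")
      case True
      have "splice_index m (\<pi> x) (\<pi> x) = \<pi> x" by (simp add: splice_index_def fun_eq_iff)
      with True D xy show ?thesis by (simp add: D_def)
    next
      case False
      have "T (splice_index m (\<pi> x) (\<pi> y)) = 0"
        by (rule zero) (use False xy \<pi>_eq \<pi> splice_index_in_multi_indices[OF \<open>m \<le> n\<close>] in auto)
      with False show ?thesis by simp
    qed
    finally show "(P * Q) $$ (x, y) = 1\<^sub>m N $$ (x, y)" using xy by simp
  qed (auto simp: P_def Q_def)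
  \<comment> \<open>A one-sided inverse of a square matrix is two-sided. Here the assumption
    \<open>r \<le> N\<close> pays off, since it is what allows both factors to be square.\<close>
  hence QP: "Q * P = 1\<^sub>m N"
    by (rule mat_mult_left_right_inverse[OF PQ_carrier])
  \<comment> \<open>Column 0 of \<open>Q * P\<close>: the weights \<open>b 0 (\<pi> x) / D x\<close>
    pair to 1 with the right factor of term 0 and to 0 with all others.\<close>
  have dual: "(\<Sum>x<N. a j (\<pi> x) * (b 0 (\<pi> x) / D x)) = (if j = 0 then 1 else 0)" if "j < N" for j
  proof -
    have "(\<Sum>x<N. a j (\<pi> x) * (b 0 (\<pi> x) / D x)) = (Q * P) $$ (j, 0)"
      using that N by (simp add: P_def Q_def scalar_prod_def lessThan_atLeast0)
    thus ?thesis using that N by (simp add: QP)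
  qed
  \<comment> \<open>Contracting the last block of \<open>T\<close> with these weights isolates term
    0. This holds for every \<open>p\<close>, not only for the chosen \<open>\<pi> x\<close>, so
    \<open>b 0\<close> inherits the linear relations common to all slices.\<close>
  have b0: "b 0 p = (\<Sum>x<N. T (splice_index m p (\<pi> x)) * (b 0 (\<pi> x) / D x))"
    if "p \<in> multi_indices n n" for p
  proof -
    have "(\<Sum>x<N. T (splice_index m p (\<pi> x)) * (b 0 (\<pi> x) / D x))
        = (\<Sum>x<N. \<Sum>j<N. b j p * (a j (\<pi> x) * (b 0 (\<pi> x) / D x)))"
      using that by (intro sum.cong refl) (simp add: T_splice \<pi> sum_distrib_right sum_divide_distrib mult.assoc)
    also have "\<dots> = (\<Sum>j<N. b j p * (\<Sum>x<N. a j (\<pi> x) * (b 0 (\<pi> x) / D x)))"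
      by (subst sum.swap) (simp add: sum_distrib_left)
    also have "\<dots> = (\<Sum>j<N. if j = 0 then b j p else 0)"
      by (intro sum.cong refl, subst dual) auto
    also have "\<dots> = b 0 p" using N by simp
    finally show ?thesis by simp
  qed
  \<comment> \<open>Otherwise entry (0, 0) of \<open>Q * P\<close> would be 0 instead of 1.\<close>
  have "\<exists>x<N. b 0 (\<pi> x) \<noteq> 0"
  proof (rule ccontr)
    assume "\<not> ?thesis"
    hence "(\<Sum>x<N. a 0 (\<pi> x) * (b 0 (\<pi> x) / D x)) = 0" by (intro sum.neutral) auto
    with dual[OF N] show False by simp
  qed
  then obtain x where x: "x < N" "b 0 (\<pi> x) \<noteq> 0" by blast
  define p where "p = \<pi> x"
  have p: "p \<in> multi_indices n n" "b 0 p \<noteq> 0" using x \<pi> by (auto simp: p_def)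
  have "b 0 (p \<circ> transpose 0 1) = \<epsilon> * b 0 p"
  proof -
    have "T (splice_index m (p \<circ> transpose 0 1) (\<pi> y)) = \<epsilon> * T (splice_index m p (\<pi> y))"
      if "y < N" for y
    proof -
      have "splice_index m (p \<circ> transpose 0 1) (\<pi> y) = splice_index m p (\<pi> y) \<circ> transpose 0 1"
        using \<open>2 \<le> m\<close> by (auto simp: splice_index_def fun_eq_iff transpose_def)
      thus ?thesis
        using swap splice_index_in_multi_indices[OF \<open>m \<le> n\<close>] p \<pi> that by simp
    qed
    moreover have "p \<circ> transpose 0 1 \<in> multi_indices n n"
      by (rule multi_indices_comp_transpose) (use assms p in auto)
    ultimately show ?thesis
      using p(1) by (simp add: b0 sum_distrib_left mult.assoc)
  qed
  hence nz: "b 0 (p \<circ> transpose 0 1) \<noteq> 0" using p \<open>\<epsilon> \<noteq> 0\<close> by simp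
  \<comment> \<open>Nonvanishing of a product can be read off slot by slot: slot 0 is nonzero at
    \<open>p 1\<close> by the swapped index, and the other slots are nonzero at the entries of
    \<open>p\<close>.\<close>
  have "b 0 (p(0 := p 1)) \<noteq> 0"
  proof -
    have "\<forall>i<m. v 0 i $ (p \<circ> transpose 0 1) i \<noteq> 0"
      using nz by (auto simp: b_def split: if_splits)
    from this[rule_format, of 0] have "v 0 0 $ p 1 \<noteq> 0" using \<open>2 \<le> m\<close> by simp
    thus ?thesis using p by (auto simp: b_def split: if_splits)
  qed
  \<comment> \<open>Slots 0 and 1 now carry the same entry, so every slice vanishes there, and with
    it their combination \<open>b 0\<close>.\<close>
  moreover have "b 0 (p(0 := p 1)) = 0"
  proof -
    have q: "p(0 := p 1) \<in> multi_indices n n"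
      using p assms by (auto simp: multi_indices_def PiE_iff extensional_def)
    have "T (splice_index m (p(0 := p 1)) (\<pi> y)) = 0" if "y < N" for y
    proof (rule zero)
      show "\<not> inj_on (splice_index m (p(0 := p 1)) (\<pi> y)) {..<n}"
      proof
        assume "inj_on (splice_index m (p(0 := p 1)) (\<pi> y)) {..<n}"
        from inj_onD[OF this, of 0 1] show False
          using assms by (simp add: splice_index_def)
      qed
    qed (use q \<pi> that splice_index_in_multi_indices[OF \<open>m \<le> n\<close>] in auto)
    thus ?thesis by (subst b0[OF q]) simp
  qed
  ultimately show False by contradiction
qed

section \<open>Tensors with prescribed coefficients on the permutations\<close>

text \<open>Common form of both tensors: \<open>c\<close> is the sign for the determinant and
  constantly 1 for the permanent.\<close>

definition perm_tensor :: "nat \<Rightarrow> ((nat \<Rightarrow> nat) \<Rightarrow> 'a::field) \<Rightarrow> 'a tensor" where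
  "perm_tensor n c =
     (\<lambda>\<iota>. \<Sum>\<sigma> | \<sigma> permutes {..<n}. c \<sigma> * elementary_tensor n n (\<lambda>i. unit_vec n (\<sigma> i)) \<iota>)"

lemma elementary_tensor_unit_vec_permutes:
  assumes "\<sigma> permutes {..<n}" "\<iota> \<in> multi_indices n n"
  shows "elementary_tensor n n (\<lambda>i. unit_vec n (\<sigma> i)) \<iota> =
    (if \<iota> = restrict \<sigma> {..<n} then 1 else 0 :: 'a::field)"
proof -
  have "(\<Prod>i<n. unit_vec n (\<sigma> i) $ \<iota> i) = (\<Prod>i<n. if \<iota> i = \<sigma> i then 1 else 0 :: 'a)"
    using assms permutes_in_image[OF assms(1)]
    by (intro prod.cong) (auto simp: multi_indices_def unit_vec_def PiE_iff)
  also have "\<dots> = (if \<forall>i<n. \<iota> i = \<sigma> i then 1 else 0)" by auto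
  also have "(\<forall>i<n. \<iota> i = \<sigma> i) \<longleftrightarrow> \<iota> = restrict \<sigma> {..<n}"
    using assms(2) by (auto simp: multi_indices_def PiE_iff extensional_def restrict_def fun_eq_iff)
  finally show ?thesis using assms(2) by (simp add: elementary_tensor_def)
qed

text \<open>Permutations of \<open>{..<n}\<close> are determined by their restrictions, so exactly
  one summand survives.\<close>

lemma perm_tensor_restrict:
  assumes "\<sigma> permutes {..<n}"
  shows "perm_tensor n c (restrict \<sigma> {..<n}) = c \<sigma>"
proof -
  have "perm_tensor n c (restrict \<sigma> {..<n}) = (\<Sum>\<tau> | \<tau> permutes {..<n}. if \<tau> = \<sigma> then c \<tau> else 0)"
    unfolding perm_tensor_def
  proof (rule sum.cong)
    fix \<tau> assume "\<tau> \<in> {\<tau>. \<tau> permutes {..<n}}"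
    hence \<tau>: "\<tau> permutes {..<n}" by simp
    have "restrict \<sigma> {..<n} = restrict \<tau> {..<n} \<longleftrightarrow> \<tau> = \<sigma>"
      using permutes_not_in[OF \<tau>] permutes_not_in[OF assms]
      by (auto simp: restrict_def fun_eq_iff) metis
    thus "c \<tau> * elementary_tensor n n (\<lambda>i. unit_vec n (\<tau> i)) (restrict \<sigma> {..<n}) =
        (if \<tau> = \<sigma> then c \<tau> else 0)"
      using elementary_tensor_unit_vec_permutes[OF \<tau> restrict_permutes_multi_indices[OF assms], where 'a='a]
      by simp
  qed simp
  also have "\<dots> = c \<sigma>" using assms finite_permutations[of "{..<n}"] by simp
  finally show ?thesis .
qed

lemma perm_tensor_not_inj:
  assumes "\<iota> \<in> multi_indices n n" "\<not> inj_on \<iota> {..<n}"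
  shows "perm_tensor n c \<iota> = 0"
  unfolding perm_tensor_def
proof (rule sum.neutral, rule ballI)
  fix \<sigma> assume "\<sigma> \<in> {\<sigma>. \<sigma> permutes {..<n}}"
  hence \<sigma>: "\<sigma> permutes {..<n}" by simp
  have "\<iota> \<noteq> restrict \<sigma> {..<n}"
    using assms(2) permutes_inj_on[OF \<sigma>] by (auto simp: inj_on_restrict_eq)
  thus "c \<sigma> * elementary_tensor n n (\<lambda>i. unit_vec n (\<sigma> i)) \<iota> = 0"
    using elementary_tensor_unit_vec_permutes[OF \<sigma> assms(1), where 'a='a] by simp
qed

text \<open>On an injective index the swap replaces \<sigma> by its composition with the
  transposition; on any other index both sides vanish.\<close>

lemma perm_tensor_swap:
  assumes "2 \<le> n" "\<iota> \<in> multi_indices n n"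
    and c: "\<And>\<sigma>. \<sigma> permutes {..<n} \<Longrightarrow> c (\<sigma> \<circ> transpose 0 1) = \<epsilon> * c \<sigma>"
  shows "perm_tensor n c (\<iota> \<circ> transpose 0 1) = \<epsilon> * perm_tensor n c \<iota>"
proof -
  have t: "transpose 0 1 permutes {..<n}"
    using assms(1) by (intro permutes_swap_id) auto
  show ?thesis
  proof (cases "inj_on \<iota> {..<n}")
    case True
    then obtain \<sigma> where \<sigma>: "\<sigma> permutes {..<n}" "\<iota> = restrict \<sigma> {..<n}"
      using inj_multi_index_permutes assms(2) by blast
    have "\<iota> \<circ> transpose 0 1 = restrict (\<sigma> \<circ> transpose 0 1) {..<n}"
      using assms(1) \<sigma>(2) by (auto simp: restrict_def fun_eq_iff transpose_def)
    thus ?thesis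
      using \<sigma> c perm_tensor_restrict permutes_compose[OF t \<sigma>(1)] by metis
  next
    case False
    have "\<not> inj_on (\<iota> \<circ> transpose 0 1) {..<n}"
      using False permutes_image[OF t] permutes_inj_on[OF t] comp_inj_on_iff by metis
    moreover have "\<iota> \<circ> transpose 0 1 \<in> multi_indices n n"
      by (rule multi_indices_comp_transpose) (use assms in auto)
    ultimately show ?thesis using False assms(2) by (simp add: perm_tensor_not_inj)
  qed
qed

text \<open>\<open>Trank\<close> is a \<open>LEAST\<close>, which is attained only once some
  decomposition is known to exist.\<close>

lemma ex_is_sum_of_elementary_perm_tensor:
  fixes c :: "(nat \<Rightarrow> nat) \<Rightarrow> 'a::field"
  assumes "0 < n"
  shows "\<exists>r. is_sum_of_elementary n n (perm_tensor n c) r"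
proof -
  let ?S = "{\<sigma>. \<sigma> permutes {..<n}}"
  obtain h where h: "bij_betw h {..<card ?S} ?S"
    using ex_bij_betw_nat_finite[OF finite_permutations[of "{..<n}"]] by (auto simp: lessThan_atLeast0)
  \<comment> \<open>The scalar is absorbed into the vector of slot 0, which exists because
    \<open>0 < n\<close>.\<close>
  define w where "w \<sigma> i = (if i = 0 then c \<sigma> else 1) \<cdot>\<^sub>v unit_vec n (\<sigma> i)" for \<sigma> and i :: nat
  have w: "c \<sigma> * elementary_tensor n n (\<lambda>i. unit_vec n (\<sigma> i)) \<iota> = elementary_tensor n n (w \<sigma>) \<iota>"
    for \<sigma> \<iota>
  proof (cases "\<iota> \<in> multi_indices n n")
    case True
    hence "(\<Prod>i<n. w \<sigma> i $ \<iota> i) = (\<Prod>i<n. (if i = 0 then c \<sigma> else 1) * unit_vec n (\<sigma> i) $ \<iota> i)"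
      by (intro prod.cong) (auto simp: w_def multi_indices_def PiE_iff)
    also have "\<dots> = c \<sigma> * (\<Prod>i<n. unit_vec n (\<sigma> i) $ \<iota> i)"
      using assms by (simp add: prod.distrib)
    finally show ?thesis using True by (simp add: elementary_tensor_def)
  qed (simp add: elementary_tensor_def)
  have "perm_tensor n c = (\<lambda>\<iota>. \<Sum>j<card ?S. elementary_tensor n n (w (h j)) \<iota>)"
    unfolding perm_tensor_def w by (intro ext sum.reindex_bij_betw[OF h, symmetric])
  moreover have "w \<sigma> i \<in> carrier_vec n" for \<sigma> i by (simp add: w_def)
  ultimately have "is_sum_of_elementary n n (perm_tensor n c) (card ?S)"
    unfolding is_sum_of_elementary_def by (intro exI[of _ "\<lambda>j. w (h j)"]) auto
  thus ?thesis ..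
qed

lemma Trank_perm_tensor_gt_choose:
  fixes c :: "(nat \<Rightarrow> nat) \<Rightarrow> 'a::field"
  assumes "2 \<le> m" "m \<le> n"
    and nonzero: "\<And>\<sigma>. \<sigma> permutes {..<n} \<Longrightarrow> c \<sigma> \<noteq> 0"
    and swap: "\<And>\<sigma>. \<sigma> permutes {..<n} \<Longrightarrow> c (\<sigma> \<circ> transpose 0 1) = \<epsilon> * c \<sigma>" and "\<epsilon> \<noteq> 0"
  shows "n choose m < Trank n n (perm_tensor n c)"
proof (rule is_sum_of_elementary_gt_choose[OF assms(1,2)])
  have n: "0 < n" "2 \<le> n" using assms(1,2) by simp_all
  show "is_sum_of_elementary n n (perm_tensor n c) (Trank n n (perm_tensor n c))"
    unfolding Trank_def by (rule LeastI_ex[OF ex_is_sum_of_elementary_perm_tensor[OF n(1)]])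
  show "perm_tensor n c \<iota> \<noteq> 0" if inj: "\<iota> \<in> multi_indices n n" "inj_on \<iota> {..<n}" for \<iota>
  proof -
    obtain \<sigma> where "\<sigma> permutes {..<n}" "\<iota> = restrict \<sigma> {..<n}"
      by (rule inj_multi_index_permutes[OF inj])
    thus ?thesis by (simp add: perm_tensor_restrict nonzero)
  qed
  show "perm_tensor n c (\<iota> \<circ> transpose 0 1) = \<epsilon> * perm_tensor n c \<iota>"
    if "\<iota> \<in> multi_indices n n" for \<iota>
    using n(2) that swap by (rule perm_tensor_swap)
qed (fact perm_tensor_not_inj \<open>\<epsilon> \<noteq> 0\<close>)+

theorem theorem6p1:
  fixes n :: nat
  assumes "n \<ge> 3"
  shows "Trank n n (det_tensor n :: 'a::field tensor) \<ge> (n choose (n div 2)) + 1 \<and>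
         Trank n n (per_tensor n :: 'a::field tensor) \<ge> (n choose (n div 2)) + 1"
proof -
  \<comment> \<open>The larger half goes first: for \<open>n = 3\<close> the smaller one has a
    single slot and leaves nothing to swap. Binomial symmetry restores the stated form.\<close>
  have m: "2 \<le> n - n div 2" "n - n div 2 \<le> n" using assms by auto
  have choose: "n choose (n - n div 2) = n choose (n div 2)"
    by (rule binomial_symmetric[symmetric]) simp
  \<comment> \<open>Signs are nonzero in every field; this includes characteristic 2, where the
    factor -1 equals 1.\<close>
  have "n choose (n - n div 2) < Trank n n (perm_tensor n (\<lambda>\<sigma>. of_int (sign \<sigma>) :: 'a))"
  proof (rule Trank_perm_tensor_gt_choose[OF m])
    fix \<sigma> :: "nat \<Rightarrow> nat" assume "\<sigma> permutes {..<n}"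
    hence "permutation \<sigma>" by (auto simp: permutation_permutes)
    thus "of_int (sign (\<sigma> \<circ> transpose 0 1)) = (- 1 :: 'a) * of_int (sign \<sigma>)"
      by (simp add: sign_compose permutation_swap_id sign_swap_id)
  qed (auto simp: sign_def)
  moreover have "n choose (n - n div 2) < Trank n n (perm_tensor n (\<lambda>_. 1 :: 'a))"
    by (rule Trank_perm_tensor_gt_choose[OF m, where \<epsilon> = 1]) auto
  moreover have "det_tensor n = perm_tensor n (\<lambda>\<sigma>. of_int (sign \<sigma>) :: 'a)"
    "per_tensor n = perm_tensor n (\<lambda>_. 1 :: 'a)"
    by (simp_all add: det_tensor_def per_tensor_def perm_tensor_def)
  ultimately show ?thesis by (simp add: choose)
qed

end
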